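(* Let $N>1$ be an integer with prime factorization $N=p_1^{a_1}\cdots p_r^{a_r}$. Let $\mathcal{K}\subseteq\mathbb{Z}_N$ be a difference set with parameters $(N,K,\nu)$ such that $\nu<\min\{p_1,\dots,p_r\}$ and $K<\min\{p_1,\dots,p_r\}$. Then, for $g=\chi_{\mathcal{K}}$, $$\langle g,g_\mu\rangle\neq0\quad\text{for every }\mu\in\mathbb{Z}_N^2.$$
   Context: Vectors in $\mathbb{C}^N$ are indexed by $\mathbb{Z}_N=\mathbb{Z}/N\mathbb{Z}$, and $\omega=e^{2\pi i/N}$. The scalar product is $\langle x,y\rangle=\sum_{j\in\mathbb{Z}_N}\overline{x(j)}\,y(j)$. Translations and modulations are $(T_px)(n)=x(n-p)$ and $(M_\ell x)(n)=\omega^{\ell n}x(n)$ for $p,\ell\in\mathbb{Z}_N$. For $\mu=(p,\ell)\in\mathbb{Z}_N^2$ put $g_\mu=M_\ell T_pg$. A subset $\mathcal{K}=\{u_1,\dots,u_K\}$ of $\mathbb{Z}_N$ (with $K$ elements) is an $(N,K,\nu)$ difference set if the $K(K-1)$ differences $u_k-u_l \bmod N$, $k\neq l$, take all possible nonzero values $1,2,\dots,N-1$, each value appearing exactly $\nu$ times (so $\nu\ge1$). $\chi_{\mathcal{K}}\in\{0,1\}^N$ is the characteristic function of $\mathcal{K}$: $\chi_{\mathcal{K}}(j)=1$ if $j\in\mathcal{K}$ and $0$ otherwise. *)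

theory Defs
  imports
    Complex_Main
    "HOL-Library.Indicator_Function"
    "HOL-Computational_Algebra.Primes"
begin

text \<open>
  The residue ring modulo \<open>N\<close> is represented by the integers \<open>0, \<dots>, N - 1\<close>, with differences
  reduced modulo \<open>N\<close>. A vector indexed by it is a function \<open>int \<Rightarrow> complex\<close> of which only the
  values on \<open>Z_mod N\<close> matter.
\<close>

definition Z_mod :: "nat \<Rightarrow> int set" where
  "Z_mod N = {0..<int N}"

definition root_omega :: "nat \<Rightarrow> complex" where
  "root_omega N = exp (2 * complex_of_real pi * \<i> / of_nat N)"

definition scalar_prod :: "nat \<Rightarrow> (int \<Rightarrow> complex) \<Rightarrow> (int \<Rightarrow> complex) \<Rightarrow> complex" where
  "scalar_prod N x y = (\<Sum>j\<in>Z_mod N. cnj (x j) * y j)"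

definition translation :: "nat \<Rightarrow> int \<Rightarrow> (int \<Rightarrow> complex) \<Rightarrow> int \<Rightarrow> complex" where
  "translation N p x = (\<lambda>n. x ((n - p) mod int N))"

definition modulation :: "nat \<Rightarrow> int \<Rightarrow> (int \<Rightarrow> complex) \<Rightarrow> int \<Rightarrow> complex" where
  "modulation N l x = (\<lambda>n. root_omega N powi (l * n) * x n)"

definition tf_shift :: "nat \<Rightarrow> int \<times> int \<Rightarrow> (int \<Rightarrow> complex) \<Rightarrow> int \<Rightarrow> complex" where
  "tf_shift N \<mu> g = modulation N (snd \<mu>) (translation N (fst \<mu>) g)"

definition difference_set :: "nat \<Rightarrow> nat \<Rightarrow> nat \<Rightarrow> int set \<Rightarrow> bool" where
  "difference_set N K \<nu> \<K> \<longleftrightarrow>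
     \<K> \<subseteq> Z_mod N \<and> card \<K> = K \<and> \<nu> \<ge> 1 \<and>
     (\<forall>d\<in>Z_mod N - {0}. card {(u, v). u \<in> \<K> \<and> v \<in> \<K> \<and> u \<noteq> v \<and> (u - v) mod int N = d} = \<nu>)"

end

theory Submission
  imports Defs "HOL-Computational_Algebra.Polynomial_Factorial"
begin

text \<open>
  Only those \<open>j\<close> with both \<open>j\<close> and \<open>j - p\<close> in the difference set contribute to the scalar
  product, and each of them contributes an \<open>N\<close>-th root of unity. For \<open>p = 0\<close> there are \<open>K\<close> of
  them, otherwise \<open>\<nu>\<close>. In both cases their number is positive and smaller than every prime
  factor of \<open>N\<close>, and the theorem becomes a statement about vanishing sums of roots of unity:
  a nonempty sum of \<open>m\<close> roots of unity of order dividing \<open>N\<close>, with \<open>m\<close> smaller than every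
  prime factor of \<open>N\<close>, is not zero (\<open>sum_roots_of_unity_nonzero\<close>).

  For this, write the terms as powers of one root of unity \<open>z\<close> and suppose that they sum to zero.
  If \<open>1 \<le> k \<le> m\<close>, then \<open>k\<close> is coprime to \<open>N\<close>, so that replacing \<open>z\<close> by \<open>z ^ k\<close> preserves
  all polynomial relations with integer coefficients (\<open>int_poly_root_power_coprime\<close>). Thus the
  first \<open>m\<close> power sums of the \<open>m\<close> terms vanish, which is impossible for nonzero numbers:
  a polynomial without constant term and of degree at most \<open>m\<close> can be chosen to vanish at all
  values of the terms except one, and then its values at the terms do not sum to zero.

  The invariance under \<open>z \<mapsto> z ^ k\<close> reduces to the case of a prime \<open>k = q\<close> not dividing \<open>N\<close>.
  Let \<open>P\<close> be the monic integer polynomial of least degree with root \<open>z\<close>, and let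
  \<open>x ^ N - 1 = P h\<close>. The Frobenius congruence makes \<open>P (z ^ q)\<close> a multiple of \<open>q\<close> in the ring
  generated by \<open>z\<close>. If it were nonzero, then \<open>h (z ^ q) = 0\<close>, and differentiating \<open>x ^ N - 1 = P h\<close>
  at \<open>z ^ q\<close> would make \<open>N\<close> a multiple of \<open>P (z ^ q)\<close>, hence of \<open>q\<close>, in that ring. But then
  \<open>q\<close> would divide \<open>N\<close> in the integers.
\<close>

section \<open>Evaluating integer polynomials in commutative rings\<close>

definition int_poly_eval :: "'a::comm_ring_1 \<Rightarrow> int poly \<Rightarrow> 'a" where
  "int_poly_eval z f = poly (map_poly of_int f) z"

lemma int_poly_eval_0 [simp]: "int_poly_eval z 0 = 0"
  by (simp add: int_poly_eval_def)

lemma int_poly_eval_pCons [simp]: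
  "int_poly_eval z (pCons a f) = of_int a + z * int_poly_eval z f"
  by (simp add: int_poly_eval_def map_poly_pCons)

lemma int_poly_eval_1 [simp]: "int_poly_eval z 1 = 1"
  unfolding one_pCons by simp

lemma int_poly_eval_add [simp]:
  "int_poly_eval z (f + g) = int_poly_eval z f + int_poly_eval z g"
  by (induction f g rule: poly_induct2) (simp_all add: algebra_simps)

lemma int_poly_eval_minus [simp]: "int_poly_eval z (- f) = - int_poly_eval z f"
  by (induction f) simp_all

lemma int_poly_eval_diff [simp]:
  "int_poly_eval z (f - g) = int_poly_eval z f - int_poly_eval z g"
  using int_poly_eval_add[of z f "- g"] by simp

lemma int_poly_eval_smult [simp]:
  "int_poly_eval z (smult a f) = of_int a * int_poly_eval z f"
  by (induction f) (simp_all add: algebra_simps)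

lemma int_poly_eval_mult [simp]:
  "int_poly_eval z (f * g) = int_poly_eval z f * int_poly_eval z g"
  by (induction f) (simp_all add: algebra_simps)

lemma int_poly_eval_power [simp]: "int_poly_eval z (f ^ n) = int_poly_eval z f ^ n"
  by (induction n) simp_all

lemma int_poly_eval_monom [simp]: "int_poly_eval z (monom a n) = of_int a * z ^ n"
  by (induction n) (simp_all add: monom_0 monom_Suc)

lemma int_poly_eval_sum [simp]:
  "int_poly_eval z (\<Sum>i\<in>A. f i) = (\<Sum>i\<in>A. int_poly_eval z (f i))"
  by (induction A rule: infinite_finite_induct) simp_all

lemma int_poly_eval_pcompose [simp]:
  "int_poly_eval z (pcompose f g) = int_poly_eval (int_poly_eval z g) f"
  by (induction f) (simp_all add: pcompose_pCons)

section \<open>The minimal polynomial over the integers\<close>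

text \<open>
  Among the nonzero integer polynomials with root \<open>z\<close>, take one of least degree and remove its
  content. Pseudo-division of \<open>f\<close> by it leaves no remainder, so it divides a multiple \<open>a f\<close>; by
  Gauss's lemma \<open>a\<close> divides the content of the cofactor and can be cancelled. In particular it
  divides the monic \<open>m\<close>, which forces its leading coefficient to be a unit.
\<close>

lemma minimal_polynomial_algebraic_int:
  fixes z :: "'a::{idom, ring_char_0}"
  assumes "lead_coeff m = 1" and "int_poly_eval z m = 0"
  obtains P :: "int poly" where "lead_coeff P = 1"
    and "\<And>f. int_poly_eval z f = 0 \<longleftrightarrow> P dvd f"
proof -
  let ?root = "\<lambda>f. f \<noteq> 0 \<and> int_poly_eval z f = 0"
  have "?root m" using assms by auto
  then obtain Q where Q: "?root Q" and Q_min: "\<And>f. ?root f \<Longrightarrow> degree Q \<le> degree f"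
    using ex_has_least_nat[of ?root m degree] by blast
  define P where "P = primitive_part Q"
  have Q_eq: "Q = smult (content Q) P"
    by (simp add: P_def)
  have "content Q \<noteq> 0" using Q by simp
  then have P: "?root P"
    using Q Q_eq by (metis int_poly_eval_smult mult_eq_0_iff of_int_eq_0_iff smult_0_right)
  have content_P: "content P = 1"
    using Q by (simp add: P_def content_primitive_part)
  have P_dvd: "P dvd f" if f: "int_poly_eval z f = 0" for f
  proof -
    obtain a u where a: "a \<noteq> 0" and eq: "smult a f = P * u + pseudo_mod f P"
      using pseudo_mod(1)[of P f] P by blast
    have "int_poly_eval z (pseudo_mod f P) = 0"
      using arg_cong[OF eq, of "int_poly_eval z"] f P by simp
    moreover have "pseudo_mod f P = 0 \<or> degree (pseudo_mod f P) < degree Q"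
      using pseudo_mod(2)[of P f] P by (simp add: P_def)
    ultimately have "pseudo_mod f P = 0"
      using Q_min[of "pseudo_mod f P"] by linarith
    then have eq: "smult a f = P * u" using eq by simp
    have "content u = normalize a * content f"
      using arg_cong[OF eq, of content] content_P by (simp add: content_mult)
    then have "[:a:] dvd u"
      by (simp add: const_poly_dvd_iff_dvd_content)
    then obtain w where "u = smult a w" by (auto elim!: dvdE)
    then have "smult a f = smult a (P * w)" using eq by simp
    then show ?thesis using a by (metis dvd_triv_left smult_eq_iff divide_self_if smult_cancel)
  qed
  have "P dvd m" using P_dvd assms(2) by blast
  then obtain w where "m = P * w" ..
  then have "lead_coeff P * lead_coeff w = 1"
    using assms(1) by (simp add: lead_coeff_mult)
  then have unit: "lead_coeff P = 1 \<or> lead_coeff P = - 1"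
    using zmult_eq_1_iff by blast
  have iff: "int_poly_eval z f = 0 \<longleftrightarrow> P dvd f" for f
    using P_dvd P by auto
  from unit show thesis
  proof
    assume "lead_coeff P = 1"
    then show thesis using that[of P] iff by blast
  next
    assume "lead_coeff P = - 1"
    then show thesis using that[of "- P"] iff by simp
  qed
qed

section \<open>The Frobenius congruence for integer polynomials\<close>

lemma prime_dvd_power_add_diff:
  fixes a b :: "'a::comm_ring_1"
  assumes "prime q"
  shows "of_nat q dvd (a + b) ^ q - (a ^ q + b ^ q)"
proof -
  have q: "q > 0" using assms by (simp add: prime_gt_0_nat)
  have split: "{..q} = insert 0 (insert q {1..<q})" using q by auto
  have "(a + b) ^ q = (\<Sum>k\<le>q. of_nat (q choose k) * a ^ k * b ^ (q - k))"
    by (rule binomial_ring)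
  also have "\<dots> = b ^ q + (a ^ q + (\<Sum>k=1..<q. of_nat (q choose k) * a ^ k * b ^ (q - k)))"
    unfolding split using q by simp
  finally have eq: "(a + b) ^ q - (a ^ q + b ^ q)
      = (\<Sum>k=1..<q. of_nat (q choose k) * a ^ k * b ^ (q - k))"
    by simp
  show ?thesis
    unfolding eq
  proof (rule dvd_sum)
    fix k assume "k \<in> {1..<q}"
    then have "q dvd (q choose k)"
      using assms by (intro dvd_choose_prime) auto
    then have "(of_nat q :: 'a) dvd of_nat (q choose k)"
      by (auto elim!: dvdE)
    then show "(of_nat q :: 'a) dvd of_nat (q choose k) * a ^ k * b ^ (q - k)"
      by (simp add: mult.assoc)
  qed
qed

text \<open>
  Fermat's little theorem on all integers. By the previous lemma, the divisibility passes between
  \<open>b\<close> and \<open>b + 1\<close> in both directions, so it spreads from \<open>0\<close>.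
\<close>

lemma prime_dvd_int_power_diff:
  assumes "prime q"
  shows "int q dvd a ^ q - a"
proof -
  have q: "q > 0" using assms by (simp add: prime_gt_0_nat)
  have step: "int q dvd (b + 1) ^ q - (b + 1) \<longleftrightarrow> int q dvd b ^ q - b" for b
  proof -
    have "int q dvd (b + 1) ^ q - (b ^ q + 1)"
      using prime_dvd_power_add_diff[OF assms, of b "1::int"] by simp
    moreover have "(b + 1) ^ q - (b + 1) = ((b + 1) ^ q - (b ^ q + 1)) + (b ^ q - b)"
      by simp
    ultimately show ?thesis by (metis dvd_add_right_iff)
  qed
  show ?thesis
  proof (induction a rule: int_induct[of _ 0])
    case base
    then show ?case using q by (simp add: power_0_left)
  next
    case (step1 i)
    then show ?case using step by blast
  next
    case (step2 i)
    then show ?case using step[of "i - 1"] by simp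
  qed
qed

text \<open>
  The composition with \<open>monom 1 q\<close> is \<open>f (x ^ q)\<close>. The congruence holds because taking \<open>q\<close>-th
  powers is additive modulo \<open>q\<close> and fixes the coefficients by Fermat.
\<close>

lemma frobenius_int_poly:
  fixes f :: "int poly"
  assumes "prime q"
  shows "[:int q:] dvd f ^ q - pcompose f (monom 1 q)"
proof (induction f)
  case 0
  then show ?case using assms by (simp add: prime_gt_0_nat power_0_left)
next
  case (pCons a f)
  let ?X = "monom 1 1 :: int poly"
  have split: "pCons a f = [:a:] + ?X * f"
    by (simp add: monom_Suc monom_0)
  have of_nat_q: "of_nat q = [:int q:]"
    by (simp add: of_nat_poly)
  have "[:int q:] dvd (pCons a f) ^ q - ([:a:] ^ q + (?X * f) ^ q)"
    using prime_dvd_power_add_diff[OF assms, of "[:a:]" "?X * f"] split of_nat_q by simp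
  moreover have "[:int q:] dvd [:a:] ^ q - [:a:]"
    using prime_dvd_int_power_diff[OF assms, of a]
    by (simp add: poly_const_pow const_poly_dvd_iff coeff_pCons split: nat.split)
  moreover have "[:int q:] dvd monom 1 q * (f ^ q - pcompose f (monom 1 q))"
    using pCons.IH by (rule dvd_mult)
  moreover have "(pCons a f) ^ q - pcompose (pCons a f) (monom 1 q)
      = ((pCons a f) ^ q - ([:a:] ^ q + (?X * f) ^ q)) + ([:a:] ^ q - [:a:])
        + monom 1 q * (f ^ q - pcompose f (monom 1 q))"
    by (simp add: pcompose_pCons power_mult_distrib monom_power algebra_simps)
  ultimately show ?case by (metis dvd_add)
qed

section \<open>Conjugate roots of unity\<close>

text \<open>
  This is the arithmetic core: the substance of the irreducibility of cyclotomic polynomials. It is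
  enough to treat the minimal polynomial \<open>P\<close> of \<open>z\<close>, as it divides \<open>f\<close>. A nonzero
  \<open>P (z ^ q)\<close> would be both a multiple of \<open>q\<close> and a divisor of \<open>N\<close> in the ring
  of integer polynomials in \<open>z\<close>.
\<close>

lemma int_poly_root_power_prime:
  fixes z :: "'a::{idom, ring_char_0}"
  assumes N: "N > 0" and z: "z ^ N = 1" and q: "prime q" "\<not> q dvd N"
    and f: "int_poly_eval z f = 0"
  shows "int_poly_eval (z ^ q) f = 0"
proof -
  define m :: "int poly" where "m = monom 1 N - 1"
  have "lead_coeff m = 1"
  proof -
    have "degree m = N"
      using N degree_add_eq_left[of "- 1 :: int poly" "monom 1 N"]
      by (simp add: m_def degree_monom_eq)
    then show ?thesis using N by (simp add: m_def)
  qed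
  moreover have "int_poly_eval z m = 0" by (simp add: m_def z)
  ultimately obtain P :: "int poly" where monic: "lead_coeff P = 1"
    and root_iff: "\<And>f. int_poly_eval z f = 0 \<longleftrightarrow> P dvd f"
    by (rule minimal_polynomial_algebraic_int) blast
  have "int_poly_eval (z ^ q) P = 0"
  proof (rule ccontr)
    assume P_nz: "int_poly_eval (z ^ q) P \<noteq> 0"
    obtain h where h: "m = P * h"
      using root_iff \<open>int_poly_eval z m = 0\<close> by (auto elim: dvdE)
    have P0: "int_poly_eval z P = 0" using root_iff by simp
    obtain s where s: "P ^ q - pcompose P (monom 1 q) = [:int q:] * s"
      using frobenius_int_poly[OF q(1), of P] by (auto elim: dvdE)
    have P_eval: "int_poly_eval (z ^ q) P = - of_nat q * int_poly_eval z s"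
    proof -
      have "- int_poly_eval (z ^ q) P = of_nat q * int_poly_eval z s"
        using arg_cong[OF s, of "int_poly_eval z"] P0 prime_gt_0_nat[OF q(1)]
        by (simp add: power_0_left)
      then show ?thesis by (metis minus_minus mult_minus_left)
    qed
    have zq: "(z ^ q) ^ N = 1" by (metis z power_mult mult.commute power_one)
    have "int_poly_eval (z ^ q) m = 0" by (simp add: m_def zq)
    then have h0: "int_poly_eval (z ^ q) h = 0" using h P_nz by simp
    \<comment> \<open>As \<open>h\<close> vanishes at \<open>z ^ q\<close>, only the summand \<open>P h'\<close> of the derivative \<open>N x ^ (N - 1)\<close>
      of \<open>m\<close> survives there.\<close>
    have "monom (int N) (N - 1) = pderiv m"
      by (simp add: m_def pderiv_diff pderiv_monom)
    also have "\<dots> = P * pderiv h + h * pderiv P" by (simp add: h pderiv_mult)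
    finally have deriv_eq: "of_nat N * (z ^ q) ^ (N - 1)
        = int_poly_eval (z ^ q) P * int_poly_eval (z ^ q) (pderiv h)"
      using h0 by (metis (no_types, lifting) add.right_neutral int_poly_eval_add int_poly_eval_monom
          int_poly_eval_mult mult_zero_left of_int_of_nat_eq)
    have "of_nat N * ((z ^ q) ^ (N - 1) * z ^ q) = (of_nat N * (z ^ q) ^ (N - 1)) * z ^ q"
      by (simp only: mult.assoc)
    also have "\<dots> = of_nat q * (- int_poly_eval z s * int_poly_eval (z ^ q) (pderiv h) * z ^ q)"
      unfolding deriv_eq P_eval by (simp add: mult_ac)
    also have "(z ^ q) ^ (N - 1) * z ^ q = 1"
      using zq N by (metis power_minus_mult)
    finally have N_eq: "of_nat N = of_nat q * (- int_poly_eval z s * int_poly_eval (z ^ q) (pderiv h) * z ^ q)"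
      by simp
    \<comment> \<open>So \<open>N = q r(z)\<close>. Reduced modulo \<open>P\<close>, this becomes an identity of polynomials
      of degree less than that of \<open>P\<close>, whose constant coefficients can be compared.\<close>
    define r where "r = - s * pcompose (pderiv h) (monom 1 q) * monom 1 q"
    obtain u t where ut: "r = P * u + t" and t: "t = 0 \<or> degree t < degree P"
    proof -
      obtain u t where "pseudo_divmod r P = (u, t)" by (cases "pseudo_divmod r P")
      moreover have "P \<noteq> 0" using monic by auto
      ultimately show thesis using pseudo_divmod[of P r u t] monic that by simp
    qed
    have "int_poly_eval z ([:int N:] - smult (int q) t) = 0"
    proof -
      have "int_poly_eval z t = int_poly_eval z r" using ut P0 by simp
      then show ?thesis using N_eq by (simp add: r_def)
    qed
    then have dvd: "P dvd [:int N:] - smult (int q) t" using root_iff by blast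
    have "degree P > 0"
    proof (rule ccontr)
      assume "\<not> degree P > 0"
      then have "P = 1" using monic by (auto elim!: degree_eq_zeroE simp: one_pCons)
      then show False using P0 by simp
    qed
    then have "degree ([:int N:] - smult (int q) t) < degree P"
      using t by (intro degree_diff_less) auto
    then have "[:int N:] - smult (int q) t = 0"
      using dvd dvd_imp_degree_le by (metis leD)
    then have "int N = int q * coeff t 0"
      by (metis coeff_pCons_0 coeff_smult eq_iff_diff_eq_0)
    then have "q dvd N" by (metis dvd_triv_left int_dvd_int_iff)
    then show False using q(2) by simp
  qed
  moreover obtain w where "f = P * w" using f root_iff by (auto elim: dvdE)
  ultimately show ?thesis by simp
qed

lemma int_poly_root_power_coprime:
  fixes z :: "'a::{idom, ring_char_0}"
  assumes "N > 0" "z ^ N = 1" "int_poly_eval z f = 0" "k > 0" "coprime k N"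
  shows "int_poly_eval (z ^ k) f = 0"
  using assms(4,5)
proof (induction k rule: prime_divisors_induct)
  case (factor q k)
  have "\<not> q dvd N"
    using factor.hyps factor.prems(2) by (metis coprime_mult_left_iff coprime_absorb_left not_prime_unit)
  moreover have "int_poly_eval (z ^ k) f = 0"
    using factor by simp
  moreover have "(z ^ k) ^ N = 1" by (metis assms(2) power_mult mult.commute power_one)
  ultimately have "int_poly_eval ((z ^ k) ^ q) f = 0"
    using int_poly_root_power_prime assms(1) factor.hyps by blast
  then show ?case by (simp add: power_mult[symmetric] mult.commute)
qed (use assms in auto)

section \<open>Short sums of roots of unity\<close>

text \<open>
  If the sum vanished, then so would the sums of the \<open>k\<close>-th powers of its terms for
  \<open>1 \<le> k \<le> card S\<close>, since such \<open>k\<close> are coprime to \<open>N\<close>. By linearity the values at the terms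
  of any polynomial without constant coefficient and of degree at most \<open>card S\<close> would sum to zero.
  The polynomial \<open>L\<close> below, which vanishes at all values of the terms but \<open>v0\<close>, contradicts this.
\<close>

lemma sum_roots_of_unity_nonzero:
  fixes z :: "'a::{idom, ring_char_0}" and a :: "'b \<Rightarrow> nat"
  assumes N: "N > 0" and z: "z ^ N = 1" and S: "finite S" "S \<noteq> {}"
    and small: "\<And>q. prime q \<Longrightarrow> q dvd N \<Longrightarrow> card S < q"
  shows "(\<Sum>s\<in>S. z ^ a s) \<noteq> 0"
proof
  assume sum0: "(\<Sum>s\<in>S. z ^ a s) = 0"
  define f :: "int poly" where "f = (\<Sum>s\<in>S. monom 1 (a s))"
  have power_sum: "(\<Sum>s\<in>S. (z ^ a s) ^ k) = 0" if k: "0 < k" "k \<le> card S" for k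
  proof -
    have "coprime k N"
    proof (rule ccontr)
      assume "\<not> coprime k N"
      then obtain q where q: "prime q" "q dvd k" "q dvd N"
        by (metis coprime_iff_gcd_eq_1 gcd_nat.boundedE prime_factor_nat)
      then show False using small[of q] k dvd_imp_le[of q k] by linarith
    qed
    then have "int_poly_eval (z ^ k) f = 0"
      using int_poly_root_power_coprime[OF N z _ k(1), of f] sum0 by (simp add: f_def)
    then show ?thesis by (simp add: f_def power_mult[symmetric] mult.commute)
  qed
  obtain s0 where s0: "s0 \<in> S" using S by auto
  define V where "V = (\<lambda>s. z ^ a s) ` S"
  define v0 where "v0 = z ^ a s0"
  define L where "L = pCons 0 (\<Prod>v\<in>V - {v0}. [:- v, 1:])"
  have V: "finite V" "v0 \<in> V" using S s0 by (auto simp: V_def v0_def)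
  have "degree (\<Prod>v\<in>V - {v0}. [:- v, 1:]) \<le> card (V - {v0})"
    using degree_prod_sum_le[of "V - {v0}" "\<lambda>v. [:- v, 1:]"] V by simp
  then have deg: "degree L \<le> card S"
    using V S card_image_le[of S "\<lambda>s. z ^ a s"] degree_pCons_le[of 0 "\<Prod>v\<in>V - {v0}. [:- v, 1:]"]
      card_Suc_Diff1[of V v0] unfolding L_def V_def[symmetric] by linarith
  have coeff0: "coeff L 0 = 0" by (simp add: L_def)
  have "(\<Sum>s\<in>S. poly L (z ^ a s)) = (\<Sum>i\<le>degree L. coeff L i * (\<Sum>s\<in>S. (z ^ a s) ^ i))"
    unfolding poly_altdef sum_distrib_left by (rule sum.swap)
  also have "\<dots> = 0"
  proof (rule sum.neutral, rule ballI)
    fix i assume "i \<in> {..degree L}"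
    then show "coeff L i * (\<Sum>s\<in>S. (z ^ a s) ^ i) = 0"
      using deg coeff0 power_sum[of i] by (cases "i = 0") auto
  qed
  finally have L_sum: "(\<Sum>s\<in>S. poly L (z ^ a s)) = 0" .
  have L_other: "poly L v = 0" if "v \<in> V" "v \<noteq> v0" for v
    using that V by (auto simp: L_def poly_prod intro!: prod_zero)
  have "(\<Sum>s\<in>S. poly L (z ^ a s)) = (\<Sum>s\<in>S. if z ^ a s = v0 then poly L v0 else 0)"
    using L_other by (intro sum.cong) (auto simp: V_def)
  also have "\<dots> = of_nat (card {s\<in>S. z ^ a s = v0}) * poly L v0"
    using S by (simp add: sum.If_cases Int_def)
  finally have "of_nat (card {s\<in>S. z ^ a s = v0}) * poly L v0 = 0"
    using L_sum by simp
  moreover have "card {s\<in>S. z ^ a s = v0} \<noteq> 0"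
    using S s0 by (auto simp: v0_def)
  moreover have "z \<noteq> 0" using z N by (auto simp: power_0_left)
  then have "poly L v0 \<noteq> 0"
    using V by (auto simp: L_def poly_prod v0_def)
  ultimately show False by simp
qed

section \<open>Time-frequency shifts of difference sets\<close>

lemma scalar_prod_indicator_tf_shift:
  assumes "S \<subseteq> Z_mod N" and "0 \<le> l"
  shows "scalar_prod N (indicator S) (tf_shift N (p, l) (indicator S))
    = (\<Sum>j\<in>{j\<in>S. (j - p) mod int N \<in> S}. root_omega N ^ nat (l * j))"
proof -
  have fin: "finite (Z_mod N)" by (simp add: Z_mod_def)
  have "scalar_prod N (indicator S) (tf_shift N (p, l) (indicator S))
     = (\<Sum>j\<in>Z_mod N. if j \<in> {j\<in>S. (j - p) mod int N \<in> S} then root_omega N ^ nat (l * j) else 0)"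
    unfolding scalar_prod_def
  proof (rule sum.cong[OF refl])
    fix j assume "j \<in> Z_mod N"
    then have "l * j \<ge> 0" using assms(2) by (simp add: Z_mod_def)
    then have "root_omega N powi (l * j) = root_omega N ^ nat (l * j)"
      by (simp add: power_int_def)
    then show "cnj (indicator S j) * tf_shift N (p, l) (indicator S) j
      = (if j \<in> {j\<in>S. (j - p) mod int N \<in> S} then root_omega N ^ nat (l * j) else 0)"
      by (auto simp: tf_shift_def modulation_def translation_def indicator_def)
  qed
  also have "\<dots> = (\<Sum>j\<in>Z_mod N \<inter> {j\<in>S. (j - p) mod int N \<in> S}. root_omega N ^ nat (l * j))"
    using fin by (simp add: sum.inter_restrict)
  also have "Z_mod N \<inter> {j\<in>S. (j - p) mod int N \<in> S} = {j\<in>S. (j - p) mod int N \<in> S}"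
    using assms(1) by auto
  finally show ?thesis .
qed

text \<open>
  Such \<open>j\<close> correspond to the pairs \<open>(j, (j - p) mod N)\<close> in \<open>S\<close> with difference \<open>p\<close>.
\<close>

lemma difference_set_card_shift:
  assumes "difference_set N K \<nu> S" and "p \<in> Z_mod N - {0}"
  shows "card {j\<in>S. (j - p) mod int N \<in> S} = \<nu>"
proof -
  have sub: "S \<subseteq> {0..<int N}" and p: "0 < p" "p < int N"
    using assms by (auto simp: difference_set_def Z_mod_def)
  let ?D = "{(u, v). u \<in> S \<and> v \<in> S \<and> u \<noteq> v \<and> (u - v) mod int N = p}"
  have shift: "(j - (j - p) mod int N) mod int N = p" for j
    using p by (simp add: mod_diff_right_eq)
  have "bij_betw (\<lambda>j. (j, (j - p) mod int N)) {j\<in>S. (j - p) mod int N \<in> S} ?D"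
  proof (rule bij_betwI[where g = fst])
    show "(\<lambda>j. (j, (j - p) mod int N)) \<in> {j\<in>S. (j - p) mod int N \<in> S} \<rightarrow> ?D"
    proof (clarsimp simp: shift)
      fix j assume "j = (j - p) mod int N"
      then show False using shift[of j] p by simp
    qed
    have inv: "v = (u - p) mod int N" if "u \<in> S" "v \<in> S" "(u - v) mod int N = p" for u v
    proof -
      have "v = v mod int N" using sub that by auto
      also have "\<dots> = (u - (u - v) mod int N) mod int N"
        by (simp add: mod_diff_right_eq)
      finally show ?thesis using that by simp
    qed
    show "fst \<in> ?D \<rightarrow> {j\<in>S. (j - p) mod int N \<in> S}"
      using inv by force
    show "\<And>y. y \<in> ?D \<Longrightarrow> (fst y, (fst y - p) mod int N) = y"
      using inv by force
  qed auto
  then have "card {j\<in>S. (j - p) mod int N \<in> S} = card ?D" by (rule bij_betw_same_card)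
  also have "\<dots> = \<nu>" using assms by (auto simp: difference_set_def)
  finally show ?thesis .
qed

lemma root_omega_power: "N > 0 \<Longrightarrow> root_omega N ^ N = 1"
  by (simp add: root_omega_def exp_of_nat_mult[symmetric] exp_two_pi_i)

theorem proposition2p2:
  fixes N K \<nu> :: nat and \<K> :: "int set" and g :: "int \<Rightarrow> complex"
  assumes "N > 1"
    and "difference_set N K \<nu> \<K>"
    and "\<nu> < Min (prime_factors N)"
    and "K < Min (prime_factors N)"
    and "g = indicator \<K>"
  shows "\<forall>\<mu>\<in>Z_mod N \<times> Z_mod N. scalar_prod N g (tf_shift N \<mu> g) \<noteq> 0"
proof (clarify)
  fix p l
  assume p: "p \<in> Z_mod N" and l: "l \<in> Z_mod N"
  assume zero: "scalar_prod N g (tf_shift N (p, l) g) = 0"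
  let ?J = "\<lambda>p. {j\<in>\<K>. (j - p) mod int N \<in> \<K>}"
  have sub: "\<K> \<subseteq> Z_mod N" and card_K: "card \<K> = K" and nu: "\<nu> \<ge> 1"
    using assms(2) by (auto simp: difference_set_def)
  have fin: "finite \<K>" using sub by (rule finite_subset) (simp add: Z_mod_def)
  \<comment> \<open>The difference \<open>1\<close> occurs, as \<open>N > 1\<close>; this excludes the empty set, for which the case
    \<open>p = 0\<close> would fail.\<close>
  have "1 \<in> Z_mod N - {0}" using assms(1) by (simp add: Z_mod_def)
  then have "card (?J 1) = \<nu>" using difference_set_card_shift assms(2) by blast
  then have "\<K> \<noteq> {}" using nu by auto
  have "card (?J p) < Min (prime_factors N) \<and> ?J p \<noteq> {}"
  proof (cases "p = 0")
    case True
    have "j mod int N = j" if "j \<in> \<K>" for j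
      using sub that by (auto simp: Z_mod_def)
    then have "?J p = \<K>" using True by auto
    then show ?thesis using \<open>\<K> \<noteq> {}\<close> card_K assms(4) by simp
  next
    case False
    then have "card (?J p) = \<nu>" using difference_set_card_shift assms(2) p by blast
    then show ?thesis using nu assms(3) by (metis card.empty not_one_le_zero)
  qed
  moreover have "Min (prime_factors N) \<le> q" if "prime q" "q dvd N" for q
    using that assms(1) by (intro Min_le) (auto simp: prime_factors_dvd)
  ultimately have "(\<Sum>j\<in>?J p. root_omega N ^ nat (l * j)) \<noteq> 0"
    using assms(1) fin root_omega_power[of N]
    by (intro sum_roots_of_unity_nonzero[of N]) (auto intro: order.strict_trans2)
  then show False
    using zero l scalar_prod_indicator_tf_shift[OF sub, of l p] assms(5) by (simp add: Z_mod_def)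
qed

end
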